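(* Let $X,Y,Z$ be real random variables such that $(X,Y)$ has copula $C(u,v)$ and joint distribution function $H$. Assume that $X,Y,Z$ have cumulative distribution functions $F_1,F_2,F_3$ respectively, that $Z$ has a density $f_3$, and that $Z$ is independent of $(X,Y)$. Then the copula of $(X+Z,Y)$ is $$C_5(u,v)=\int_0^1 C\bigl(F_1(F_4^{-1}(u)-F_3^{-1}(t)),\,v\bigr)\,dt,$$ where $F_4(x)=\int_{-\infty}^{\infty}F_1(x-t)f_3(t)\,dt$ is the cumulative distribution function of $X+Z$.
   Context: A 2-copula is a function $C:[0,1]^2\to[0,1]$ with $C(0,x)=C(x,0)=0$, $C(1,x)=C(x,1)=x$ for all $x$ and $C(x_1,y_1)+C(x_2,y_2)-C(x_1,y_2)-C(x_2,y_1)\ge 0$ for all $[x_1,x_2]\times[y_1,y_2]\subset[0,1]^2$. A random pair $(V,W)$ with joint distribution function $H$ and marginal distribution functions $F,G$ has copula $C$ if $C$ is a 2-copula with $C(F(x),G(y))=H(x,y)$ for all real $x,y$; it is unique ("the" copula) when the marginals are continuous. For a continuous distribution function $F$, $F^{-1}(t)=\inf\{x: F(x)=t\}$, with $F^{-1}(0)=-\infty$, $\inf\emptyset=+\infty$, and $F(-\infty)=0$, $F(+\infty)=1$ for every distribution function $F$. *)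

theory Defs
  imports "HOL-Probability.Probability"
begin

text \<open>A 2-copula is represented by a total function on the plane; only its values on the
  unit square are constrained or used.\<close>

definition copula2 :: "(real \<Rightarrow> real \<Rightarrow> real) \<Rightarrow> bool" where
  "copula2 C \<longleftrightarrow>
     (\<forall>x\<in>{0..1}. \<forall>y\<in>{0..1}. C x y \<in> {0..1}) \<and>
     (\<forall>x\<in>{0..1}. C 0 x = 0 \<and> C x 0 = 0 \<and> C 1 x = x \<and> C x 1 = x) \<and>
     (\<forall>x1 x2 y1 y2. 0 \<le> x1 \<and> x1 \<le> x2 \<and> x2 \<le> 1 \<and> 0 \<le> y1 \<and> y1 \<le> y2 \<and> y2 \<le> 1 \<longrightarrow>
        C x1 y1 + C x2 y2 - C x1 y2 - C x2 y1 \<ge> 0)"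

definition joint_cdf :: "'a measure \<Rightarrow> ('a \<Rightarrow> real) \<Rightarrow> ('a \<Rightarrow> real) \<Rightarrow> real \<Rightarrow> real \<Rightarrow> real" where
  "joint_cdf M V W x y = measure M {\<omega> \<in> space M. V \<omega> \<le> x \<and> W \<omega> \<le> y}"

definition has_copula ::
  "'a measure \<Rightarrow> ('a \<Rightarrow> real) \<Rightarrow> ('a \<Rightarrow> real) \<Rightarrow> (real \<Rightarrow> real \<Rightarrow> real) \<Rightarrow> bool" where
  "has_copula M V W C \<longleftrightarrow> copula2 C \<and>
     (\<forall>x y. C (cdf (distr M borel V) x) (cdf (distr M borel W) y) = joint_cdf M V W x y)"

text \<open>Extension of a distribution function by \<open>F(-\<infinity>) = 0\<close> and \<open>F(+\<infinity>) = 1\<close>.\<close>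

definition ext_cdf :: "(real \<Rightarrow> real) \<Rightarrow> ereal \<Rightarrow> real" where
  "ext_cdf F x = (case x of ereal r \<Rightarrow> F r | PInfty \<Rightarrow> 1 | MInfty \<Rightarrow> 0)"

text \<open>In \<^typ>\<open>ereal\<close>, the infimum of the empty set is \<open>+\<infinity>\<close>. The value at 0 is set
  separately, since the set can be empty or bounded below there.\<close>

definition cdf_inv :: "(real \<Rightarrow> real) \<Rightarrow> real \<Rightarrow> ereal" where
  "cdf_inv F t = (if t = 0 then -\<infinity> else Inf {ereal x | x. F x = t})"

text \<open>Independence of random variables with values in different types. The library's
  \<open>indep_var\<close> requires both variables to take values in the same type; this is its
  characterisation \<open>indep_var_eq\<close> without that restriction (the two families below are
  already sigma-algebras, so no \<open>sigma_sets\<close> is needed).\<close>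

definition indep_rv ::
  "'a measure \<Rightarrow> 'b measure \<Rightarrow> ('a \<Rightarrow> 'b) \<Rightarrow> 'c measure \<Rightarrow> ('a \<Rightarrow> 'c) \<Rightarrow> bool" where
  "indep_rv M S U T V \<longleftrightarrow>
     U \<in> measurable M S \<and> V \<in> measurable M T \<and>
     prob_space.indep_set M {U -` A \<inter> space M | A. A \<in> sets S}
                            {V -` B \<inter> space M | B. B \<in> sets T}"

end

theory Submission imports Defs begin

text \<open>Conditioning on the independent summand \<open>Z\<close> writes the joint distribution function of
  \<open>(X + Z, Y)\<close> at \<open>(x, y)\<close> as the integral of \<open>H (x - z) y = C (F1 (x - z)) (F2 y)\<close> over the law of
  \<open>Z\<close>. As \<open>F3\<close> is continuous, that law is the image of the uniform distribution under \<open>F3\<^sup>-\<^sup>1\<close>, so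
  \<open>C5\<close> is the same integral with \<open>F4\<^sup>-\<^sup>1 u\<close> in place of \<open>x\<close>. Taking \<open>u = F4 x\<close> replaces \<open>x\<close> by
  the leftmost point of its level set, which changes events only by null sets. Finally
  \<open>C5\<close> is a copula since it averages \<open>C\<close> over transformations of the first coordinate that are
  monotone and have mean \<open>u\<close>.\<close>

section \<open>The inverse of a continuous distribution function\<close>

text \<open>The level set is closed by continuity, and bounded below because the distribution
  function tends to 0, which is less than \<open>u\<close>, at minus infinity. So its infimum is
  real and belongs to it.\<close>

lemma (in real_distribution) cdf_inv_attained:
  assumes cont: "continuous_on UNIV (cdf M)" and "0 < u" and "cdf M x = u"
  obtains r where "r \<le> x" "cdf_inv (cdf M) u = ereal r" "cdf M r = u"
proof -
  define S where "S = {x. cdf M x = u}"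
  have "eventually (\<lambda>x. cdf M x < u) at_bot"
    using cdf_lim_at_bot \<open>0 < u\<close> by (rule order_tendstoD)
  then obtain b where b: "\<And>x. x \<le> b \<Longrightarrow> cdf M x < u"
    by (auto simp: eventually_at_bot_linorder)
  have "bdd_below S"
  proof (rule bdd_belowI)
    fix y assume "y \<in> S"
    then show "b \<le> y" using b[of y] by (cases "y \<le> b") (auto simp: S_def)
  qed
  moreover have "S = cdf M -` {u}" by (auto simp: S_def)
  then have "closed S"
    using continuous_on_closed_vimage[of UNIV "cdf M"] cont by auto
  moreover have "x \<in> S" using assms by (simp add: S_def)
  ultimately have "Inf S \<in> S" and le: "\<And>y. y \<in> S \<Longrightarrow> Inf S \<le> y"
    using closed_contains_Inf[of S] by (auto intro: cInf_lower)
  then have "cdf_inv (cdf M) u = ereal (Inf S)"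
    using \<open>0 < u\<close> unfolding cdf_inv_def S_def by (auto intro!: Inf_eqI)
  then show ?thesis
    using that[of "Inf S"] \<open>Inf S \<in> S\<close> le[OF \<open>x \<in> S\<close>] by (simp add: S_def)
qed

lemma (in real_distribution) cdf_onto:
  assumes cont: "continuous_on UNIV (cdf M)" and "0 < u" "u < 1"
  obtains x where "cdf M x = u"
proof -
  have "eventually (\<lambda>x. cdf M x < u) at_bot" "eventually (\<lambda>x. u < cdf M x) at_top"
    by (rule order_tendstoD(2)[OF cdf_lim_at_bot \<open>0 < u\<close>] order_tendstoD(1)[OF cdf_lim_at_top_prob \<open>u < 1\<close>])+
  then obtain a b where ab: "cdf M a < u" "u < cdf M b"
    by (meson eventually_happens' trivial_limit_at_bot_linorder trivial_limit_at_top_linorder)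
  then have "a \<le> b" using cdf_nondecreasing[of b a] by linarith
  then obtain x where "cdf M x = u"
    using IVT'[of "cdf M" a u b] ab continuous_on_subset[OF cont] by auto
  then show ?thesis by (rule that)
qed

text \<open>Continuity confines infinite values to the end points: 0 goes to
  \<open>-\<infinity>\<close> by convention, and 1 goes to \<open>\<infinity>\<close> when its level
  set is empty.\<close>

lemma (in real_distribution) cdf_inv_cases:
  assumes cont: "continuous_on UNIV (cdf M)" and "0 \<le> u" "u \<le> 1"
  obtains "u = 0" "cdf_inv (cdf M) u = -\<infinity>"
  | r where "0 < u" "cdf_inv (cdf M) u = ereal r" "cdf M r = u"
  | "u = 1" "cdf_inv (cdf M) u = \<infinity>" "\<And>x. cdf M x < 1"
proof -
  have "\<exists>x. cdf M x = u" if "0 < u" "u < 1"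
    by (rule cdf_onto[OF cont that]) blast
  then consider "u = 0" | x where "0 < u" "cdf M x = u" | "u = 1" "\<And>x. cdf M x \<noteq> 1"
    using assms(2,3) by (cases "u = 0"; cases "u = 1") auto
  then show ?thesis
  proof cases
    case 1 then show ?thesis using that(1) by (simp add: cdf_inv_def)
  next
    case (2 x)
    then obtain r where "cdf_inv (cdf M) u = ereal r" "cdf M r = u"
      by (rule cdf_inv_attained[OF cont])
    with \<open>0 < u\<close> show ?thesis by (rule that(2))
  next
    case 3
    then have "cdf_inv (cdf M) u = \<infinity>"
      by (simp add: cdf_inv_def top_ereal_def)
    moreover have "cdf M x < 1" for x
      using 3(2)[of x] cdf_bounded_prob[of x] by simp
    ultimately show ?thesis using 3(1) by (intro that(3))
  qed
qed

lemma (in real_distribution) ext_cdf_cdf_inv: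
  assumes "continuous_on UNIV (cdf M)" "0 \<le> u" "u \<le> 1"
  shows "ext_cdf (cdf M) (cdf_inv (cdf M) u) = u"
  by (rule cdf_inv_cases[OF assms]) (auto simp: ext_cdf_def)

lemma (in real_distribution) ext_cdf_mono: "a \<le> b \<Longrightarrow> ext_cdf (cdf M) a \<le> ext_cdf (cdf M) b"
  by (cases a; cases b) (auto simp: ext_cdf_def cdf_nondecreasing cdf_nonneg cdf_bounded_prob)

lemma (in real_distribution) ext_cdf_in: "ext_cdf (cdf M) a \<in> {0..1}"
  by (cases a) (auto simp: ext_cdf_def cdf_nonneg cdf_bounded_prob)

text \<open>Since \<open>ext_cdf\<close> is monotone and undoes the inverse, a strict decrease of
  the inverse would give \<open>w \<le> u\<close>, hence \<open>u = w\<close>, which is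
  absurd.\<close>

lemma (in real_distribution) cdf_inv_mono:
  assumes "continuous_on UNIV (cdf M)" "0 \<le> u" "u \<le> w" "w \<le> 1"
  shows "cdf_inv (cdf M) u \<le> cdf_inv (cdf M) w"
proof (rule ccontr)
  assume "\<not> ?thesis"
  then have less: "cdf_inv (cdf M) w < cdf_inv (cdf M) u" by simp
  have "w \<le> u"
    using ext_cdf_mono[OF less_imp_le[OF less]] ext_cdf_cdf_inv[OF assms(1), of u]
      ext_cdf_cdf_inv[OF assms(1), of w] assms by simp
  then show False using less \<open>u \<le> w\<close> by simp
qed

section \<open>Quantile transformation\<close>

text \<open>The right-hand side is the quantile function \<open>I\<close>, characterised by the
  equivalence of \<open>t \<le> cdf M x\<close> and \<open>I t \<le> x\<close>. It lies below every
  point of the level set of \<open>t\<close>, and by continuity it belongs to that set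
  itself.\<close>

lemma (in cdf_distribution) cdf_inv_eq_pseudoinverse:
  assumes cont: "continuous_on UNIV (cdf M)" and "0 < t" "t < 1"
  shows "cdf_inv (cdf M) t = ereal (Inf {x. t \<le> cdf M x})"
proof -
  obtain x where "cdf M x = t" by (rule cdf_onto[OF cont assms(2,3)])
  with \<open>0 < t\<close> obtain r where r: "cdf_inv (cdf M) t = ereal r" "cdf M r = t"
    by (rule cdf_inv_attained[OF cont])
  have le: "I t \<le> r" and "t \<le> cdf M (I t)"
    using pseudoinverse[OF assms(2,3), of r] pseudoinverse[OF assms(2,3), of "I t"] r by simp_all
  then have "cdf M (I t) = t"
    using cdf_nondecreasing[OF le] r by simp
  with \<open>0 < t\<close> obtain r' where "r' \<le> I t" "cdf_inv (cdf M) t = ereal r'"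
    by (rule cdf_inv_attained[OF cont])
  then show ?thesis using r le by simp
qed

text \<open>Change of variables: \<open>I\<close> carries the uniform law on the open unit interval
  to \<open>M\<close>. The domain of \<open>g\<close> is \<open>ereal\<close> because the inverse
  may be infinite at 0 and 1; these two points are Lebesgue null, so \<open>g\<close> is
  unrestricted at infinity.\<close>

lemma (in real_distribution)
  fixes g :: "ereal \<Rightarrow> real"
  assumes cont_cdf: "continuous_on UNIV (cdf M)" and g: "integrable M (\<lambda>z. g (ereal z))"
  shows set_integrable_cdf_inv: "set_integrable lborel {0..1} (\<lambda>t. g (cdf_inv (cdf M) t))"
    and integral_cdf_inv: "(LBINT t:{0..1}. g (cdf_inv (cdf M) t)) = (\<integral>z. g (ereal z) \<partial>M)"
proof -
  interpret cdf_distribution M by unfold_locales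
  let ?R = "restrict_space lborel {0<..<1::real}" and ?h = "\<lambda>t. g (cdf_inv (cdf M) t)"
  have I[measurable]: "I \<in> measurable ?R borel"
    using measurable_CI by (simp add: measurable_def sets_restrict_space space_restrict_space)
  have gm: "(\<lambda>z. g (ereal z)) \<in> borel_measurable borel"
    using g by (auto cong: measurable_cong_sets)
  have eq: "indicator {0<..<1} t *\<^sub>R g (ereal (I t)) = indicator {0<..<1} t *\<^sub>R ?h t" for t
    using cdf_inv_eq_pseudoinverse[OF cont_cdf] by (auto simp: indicator_def)
  have "integrable ?R (\<lambda>t. g (ereal (I t)))"
    using integrable_distr_eq[OF I gm] g by (simp add: distr_I_eq_M)
  then have o: "integrable lborel (\<lambda>t. indicator {0<..<1} t *\<^sub>R ?h t)"
    by (subst (asm) integrable_restrict_space) (simp_all only: eq, simp)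
  have "(\<integral>z. g (ereal z) \<partial>M) = (\<integral>t. g (ereal (I t)) \<partial>?R)"
    using integral_distr[OF I gm] by (simp add: distr_I_eq_M)
  also have "\<dots> = (LBINT t. indicator {0<..<1} t *\<^sub>R ?h t)"
    by (subst integral_restrict_space) (simp_all only: eq, simp)
  finally have oi: "(LBINT t. indicator {0<..<1} t *\<^sub>R ?h t) = (\<integral>z. g (ereal z) \<partial>M)" ..
  \<comment> \<open>At the end points the quantile may be infinite, and \<open>g\<close> takes junk values there.\<close>
  have split: "(\<lambda>t. indicator {0..1} t *\<^sub>R ?h t) = (\<lambda>t. indicator {0<..<1} t *\<^sub>R ?h t
      + (indicator {0} t *\<^sub>R ?h 0 + indicator {1} t *\<^sub>R ?h 1))"
    by (rule ext) (auto simp: indicator_def)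
  have s: "integrable lborel (\<lambda>t::real. indicator {c} t *\<^sub>R ?h d)" for c d
    by simp
  show "set_integrable lborel {0..1} ?h"
    unfolding set_integrable_def split by (intro Bochner_Integration.integrable_add o s)
  show "(LBINT t:{0..1}. ?h t) = (\<integral>z. g (ereal z) \<partial>M)"
    unfolding set_lebesgue_integral_def split
    by (subst Bochner_Integration.integral_add, rule o, intro Bochner_Integration.integrable_add s)
       (subst Bochner_Integration.integral_add, auto simp: oi[simplified])
qed

section \<open>Independence and the law of a sum\<close>

text \<open>Independence makes the joint law multiplicative on measurable rectangles, and these
  determine a product of sigma-finite measures.\<close>

lemma (in prob_space) distr_indep_rv:
  assumes "indep_rv M S U T V"
  shows "distr M (S \<Otimes>\<^sub>M T) (\<lambda>\<omega>. (U \<omega>, V \<omega>)) = distr M S U \<Otimes>\<^sub>M distr M T V"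
proof (rule pair_measure_eqI[symmetric])
  have [measurable]: "U \<in> measurable M S" "V \<in> measurable M T"
    and ind: "indep_set {U -` A \<inter> space M | A. A \<in> sets S} {V -` B \<inter> space M | B. B \<in> sets T}"
    using assms by (auto simp: indep_rv_def)
  interpret U: prob_space "distr M S U" by (rule prob_space_distr) simp
  interpret V: prob_space "distr M T V" by (rule prob_space_distr) simp
  show "sigma_finite_measure (distr M S U)" "sigma_finite_measure (distr M T V)"
    by unfold_locales
  show "sets (distr M S U \<Otimes>\<^sub>M distr M T V) = sets (distr M (S \<Otimes>\<^sub>M T) (\<lambda>\<omega>. (U \<omega>, V \<omega>)))"
    by (simp cong: sets_pair_measure_cong)
  fix A B assume "A \<in> sets (distr M S U)" "B \<in> sets (distr M T V)"
  then have [measurable]: "A \<in> sets S" "B \<in> sets T" by auto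
  have "prob ((U -` A \<inter> space M) \<inter> (V -` B \<inter> space M)) = prob (U -` A \<inter> space M) * prob (V -` B \<inter> space M)"
    by (rule indep_setD[OF ind]) auto
  moreover have "(\<lambda>\<omega>. (U \<omega>, V \<omega>)) -` (A \<times> B) \<inter> space M = (U -` A \<inter> space M) \<inter> (V -` B \<inter> space M)"
    by auto
  ultimately show "emeasure (distr M S U) A * emeasure (distr M T V) B
      = emeasure (distr M (S \<Otimes>\<^sub>M T) (\<lambda>\<omega>. (U \<omega>, V \<omega>))) (A \<times> B)"
    by (simp add: emeasure_distr emeasure_eq_measure ennreal_mult)
qed

text \<open>Every preimage under the composition is already a preimage under \<open>V\<close>, so
  the second family of events only shrinks.\<close>

lemma (in prob_space) indep_rv_compose:
  assumes "indep_rv M S U T V" and [measurable]: "g \<in> measurable T T'"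
  shows "indep_rv M S U T' (\<lambda>\<omega>. g (V \<omega>))"
proof -
  have [measurable]: "V \<in> measurable M T" using assms by (simp add: indep_rv_def)
  have "g -` B \<inter> space T \<in> sets T \<and> (\<lambda>\<omega>. g (V \<omega>)) -` B \<inter> space M = V -` (g -` B \<inter> space T) \<inter> space M"
    if "B \<in> sets T'" for B
    using that measurable_space[of V M T] by auto
  then have sub: "{(\<lambda>\<omega>. g (V \<omega>)) -` B \<inter> space M | B. B \<in> sets T'} \<subseteq> {V -` B \<inter> space M | B. B \<in> sets T}"
    by blast
  have "indep_set {U -` A \<inter> space M | A. A \<in> sets S} {(\<lambda>\<omega>. g (V \<omega>)) -` B \<inter> space M | B. B \<in> sets T'}"
    using assms(1) unfolding indep_rv_def indep_set_def
    by (elim conjE indep_sets_mono_sets) (use sub in \<open>simp split: bool.split\<close>)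
  then show ?thesis using assms(1) by (simp add: indep_rv_def)
qed

text \<open>Tonelli for the product of the law of \<open>Z\<close> with that of
  \<open>(X, Y)\<close>: the slice at \<open>z\<close> of the event for the sum is the event
  \<open>X \<le> x - z\<close>, \<open>Y \<le> y\<close>.\<close>

lemma (in prob_space)
  fixes X Y Z :: "'a \<Rightarrow> real"
  assumes [measurable]: "X \<in> borel_measurable M" "Y \<in> borel_measurable M"
    and ind: "indep_rv M borel Z (borel \<Otimes>\<^sub>M borel) (\<lambda>\<omega>. (X \<omega>, Y \<omega>))"
  shows integrable_joint_cdf_shift: "integrable (distr M borel Z) (\<lambda>z. joint_cdf M X Y (x - z) y)"
    and joint_cdf_add: "joint_cdf M (\<lambda>\<omega>. X \<omega> + Z \<omega>) Y x y = (\<integral>z. joint_cdf M X Y (x - z) y \<partial>distr M borel Z)"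
proof -
  have [measurable]: "Z \<in> borel_measurable M" using ind by (simp add: indep_rv_def)
  let ?P = "distr M borel Z" and ?Q = "distr M (borel \<Otimes>\<^sub>M borel) (\<lambda>\<omega>. (X \<omega>, Y \<omega>))"
  let ?S = "{p::real \<times> real \<times> real. fst (snd p) + fst p \<le> x \<and> snd (snd p) \<le> y}"
  interpret P: prob_space ?P by (rule prob_space_distr) simp
  interpret Q: prob_space ?Q by (rule prob_space_distr) simp
  have "{p \<in> space (borel \<Otimes>\<^sub>M (borel \<Otimes>\<^sub>M borel)). fst (snd p) + fst p \<le> x \<and> snd (snd p) \<le> y} \<in> sets (borel \<Otimes>\<^sub>M (borel \<Otimes>\<^sub>M borel))"
      by measurable
    then have S: "?S \<in> sets (borel \<Otimes>\<^sub>M (borel \<Otimes>\<^sub>M borel))" by (simp add: space_pair_measure)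
  have fib: "emeasure ?Q (Pair z -` ?S) = ennreal (joint_cdf M X Y (x - z) y)" for z
  proof -
    have "Pair z -` ?S \<in> sets (borel \<Otimes>\<^sub>M borel)" using S by (rule sets_Pair1)
    moreover have "(\<lambda>\<omega>. (X \<omega>, Y \<omega>)) -` (Pair z -` ?S) \<inter> space M = {\<omega> \<in> space M. X \<omega> \<le> x - z \<and> Y \<omega> \<le> y}"
      by auto
    ultimately show ?thesis by (simp add: emeasure_distr emeasure_eq_measure joint_cdf_def)
  qed
  \<comment> \<open>Measurability in \<open>z\<close> comes from that of slice measures and is then
    carried from \<open>ennreal\<close> back to the reals.\<close>
  have "(\<lambda>z. emeasure ?Q (Pair z -` ?S)) \<in> borel_measurable borel"
    using S by (intro Q.measurable_emeasure_Pair) simp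
  then have "(\<lambda>z. enn2real (ennreal (joint_cdf M X Y (x - z) y))) \<in> borel_measurable borel"
    unfolding fib by (rule borel_measurable_enn2real)
  then have m: "(\<lambda>z. joint_cdf M X Y (x - z) y) \<in> borel_measurable borel"
    by (simp add: joint_cdf_def)
  show int: "integrable ?P (\<lambda>z. joint_cdf M X Y (x - z) y)"
    by (rule P.integrable_const_bound[of _ 1]) (use m in \<open>auto simp: joint_cdf_def\<close>)
  have "ennreal (joint_cdf M (\<lambda>\<omega>. X \<omega> + Z \<omega>) Y x y)
      = emeasure (distr M (borel \<Otimes>\<^sub>M (borel \<Otimes>\<^sub>M borel)) (\<lambda>\<omega>. (Z \<omega>, X \<omega>, Y \<omega>))) ?S"
    using S by (subst emeasure_distr)
      (auto simp: emeasure_eq_measure joint_cdf_def intro!: arg_cong[where f=prob])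
  also have "\<dots> = (\<integral>\<^sup>+z. ennreal (joint_cdf M X Y (x - z) y) \<partial>?P)"
    unfolding distr_indep_rv[OF ind] fib[symmetric]
    using S by (intro Q.emeasure_pair_measure_alt) simp
  also have "\<dots> = ennreal (\<integral>z. joint_cdf M X Y (x - z) y \<partial>?P)"
    using int by (rule nn_integral_eq_integral) (simp add: joint_cdf_def)
  finally show "joint_cdf M (\<lambda>\<omega>. X \<omega> + Z \<omega>) Y x y = (\<integral>z. joint_cdf M X Y (x - z) y \<partial>?P)"
    by (subst (asm) ennreal_inj) (auto simp: joint_cdf_def)
qed

text \<open>The sum has no atoms. Slicing now at fixed values \<open>q\<close> of
  \<open>(X, Y)\<close>, the event that the sum equals \<open>x\<close> leaves one point for
  \<open>Z\<close>, which is null.\<close>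

lemma (in prob_space) continuous_cdf_add:
  fixes X Y Z :: "'a \<Rightarrow> real"
  assumes [measurable]: "X \<in> borel_measurable M" "Y \<in> borel_measurable M"
    and ind: "indep_rv M borel Z (borel \<Otimes>\<^sub>M borel) (\<lambda>\<omega>. (X \<omega>, Y \<omega>))"
    and cont: "continuous_on UNIV (cdf (distr M borel Z))"
  shows "continuous_on UNIV (cdf (distr M borel (\<lambda>\<omega>. X \<omega> + Z \<omega>)))"
proof -
  have [measurable]: "Z \<in> borel_measurable M" using ind by (simp add: indep_rv_def)
  let ?P = "distr M borel Z" and ?Q = "distr M (borel \<Otimes>\<^sub>M borel) (\<lambda>\<omega>. (X \<omega>, Y \<omega>))"
  interpret P: real_distribution ?P by simp
  interpret Q: prob_space ?Q by (rule prob_space_distr) simp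
  interpret PQ: pair_sigma_finite ?P ?Q ..
  interpret R: real_distribution "distr M borel (\<lambda>\<omega>. X \<omega> + Z \<omega>)" by simp
  have "measure (distr M borel (\<lambda>\<omega>. X \<omega> + Z \<omega>)) {x} = 0" for x
  proof -
    let ?S = "{p::real \<times> real \<times> real. fst (snd p) + fst p = x}"
    have "{p \<in> space (borel \<Otimes>\<^sub>M (borel \<Otimes>\<^sub>M borel)). fst (snd p) + fst p = x} \<in> sets (borel \<Otimes>\<^sub>M (borel \<Otimes>\<^sub>M borel))"
      by measurable
    then have S: "?S \<in> sets (borel \<Otimes>\<^sub>M (borel \<Otimes>\<^sub>M borel))" by (simp add: space_pair_measure)
    have fib: "emeasure ?P ((\<lambda>z. (z, q)) -` ?S) = 0" for q
    proof -
      have "(\<lambda>z. (z, q)) -` ?S = {x - fst q}" by auto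
      then show ?thesis using cont P.isCont_cdf
        by (simp add: P.emeasure_eq_measure continuous_on_eq_continuous_at)
    qed
    have "emeasure (distr M borel (\<lambda>\<omega>. X \<omega> + Z \<omega>)) {x}
      = emeasure (distr M (borel \<Otimes>\<^sub>M (borel \<Otimes>\<^sub>M borel)) (\<lambda>\<omega>. (Z \<omega>, X \<omega>, Y \<omega>))) ?S"
      using S by (simp add: emeasure_distr) (auto intro!: arg_cong[where f="emeasure M"])
    also have "\<dots> = (\<integral>\<^sup>+q. emeasure ?P ((\<lambda>z. (z, q)) -` ?S) \<partial>?Q)"
      unfolding distr_indep_rv[OF ind]
      using S by (intro PQ.emeasure_pair_measure_alt2) simp
    also have "\<dots> = 0"
      unfolding fib by simp
    finally show ?thesis by (simp add: R.emeasure_eq_measure)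
  qed
  then show ?thesis by (simp add: continuous_on_eq_continuous_at R.isCont_cdf)
qed


section \<open>Copulas: bounds, averaging and uniqueness\<close>

lemma copula2_rect:
  assumes "copula2 C" "0 \<le> x1" "x1 \<le> x2" "x2 \<le> 1" "0 \<le> y1" "y1 \<le> y2" "y2 \<le> 1"
  shows "0 \<le> C x1 y1 + C x2 y2 - C x1 y2 - C x2 y1"
  using assms unfolding copula2_def by blast

lemma copula2_in:
  assumes "copula2 C" "u \<in> {0..1}" "v \<in> {0..1}"
  shows "C u v \<in> {0..1}"
  using assms unfolding copula2_def by blast

lemma copula2_margins:
  assumes "copula2 C" "x \<in> {0..1}"
  shows "C 0 x = 0" "C x 0 = 0" "C 1 x = x" "C x 1 = x"
  using assms unfolding copula2_def by blast+

lemma copula2_mono: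
  assumes "copula2 C" "0 \<le> u" "u \<le> w" "w \<le> 1" "v \<in> {0..1}"
  shows "C u v \<le> C w v"
  using copula2_rect[of C u w 0 v] copula2_margins(2)[of C] assms by simp

lemma copula2_le:
  assumes "copula2 C" "u \<in> {0..1}" "v \<in> {0..1}"
  shows "C u v \<le> v"
  using copula2_mono[of C u 1 v] copula2_margins(3)[of C v] assms by simp

text \<open>The lower Frechet-Hoeffding bound: the rectangle with corners \<open>(u, v)\<close> and
  \<open>(1, 1)\<close> has nonnegative mass.\<close>

lemma copula2_ge:
  assumes "copula2 C" "u \<in> {0..1}" "v \<in> {0..1}"
  shows "u + v - 1 \<le> C u v"
  using copula2_rect[of C u 1 v 1] copula2_margins(3,4)[of C] assms by simp

text \<open>This transfers the copula property from the integral over the law of \<open>Z\<close> to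
  \<open>C5\<close>; the two are identified only for \<open>v\<close> in the unit interval.\<close>

lemma copula2_cong:
  assumes "copula2 C" and eq: "\<And>u v. u \<in> {0..1} \<Longrightarrow> v \<in> {0..1} \<Longrightarrow> D u v = C u v"
  shows "copula2 D"
  unfolding copula2_def
proof (intro conjI ballI allI impI)
  fix x y :: real assume "x \<in> {0..1}" "y \<in> {0..1}"
  then show "D x y \<in> {0..1}" using copula2_in[OF assms(1)] by (simp only: eq)
next
  fix x :: real assume "x \<in> {0..1}"
  then show "D 0 x = 0" "D x 0 = 0" "D 1 x = x" "D x 1 = x"
    using copula2_margins[OF assms(1), of x] eq[of 0 x] eq[of x 0] eq[of 1 x] eq[of x 1] by auto
next
  fix x1 x2 y1 y2 :: real
  assume "0 \<le> x1 \<and> x1 \<le> x2 \<and> x2 \<le> 1 \<and> 0 \<le> y1 \<and> y1 \<le> y2 \<and> y2 \<le> 1"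
  then show "0 \<le> D x1 y1 + D x2 y2 - D x1 y2 - D x2 y1"
    using copula2_rect[OF assms(1), of x1 x2 y1 y2] eq[of x1 y1] eq[of x2 y2] eq[of x1 y2] eq[of x2 y1]
    by simp
qed

text \<open>The integrand is bounded by 1 and antitone in \<open>z\<close>, hence Borel; the sign in
  the proof makes it increasing.\<close>

lemma integrable_copula2_ext_cdf:
  assumes "real_distribution N" "real_distribution P" "copula2 C" "v \<in> {0..1}"
  shows "integrable N (\<lambda>z. C (ext_cdf (cdf P) (a - ereal z)) v)"
proof -
  interpret N: real_distribution N by fact
  interpret P: real_distribution P by fact
  have "mono (\<lambda>z. - C (ext_cdf (cdf P) (a - ereal z)) v)"
  proof (rule monoI)
    fix z z' :: real assume "z \<le> z'"
    then have "ext_cdf (cdf P) (a - ereal z') \<le> ext_cdf (cdf P) (a - ereal z)"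
      by (intro P.ext_cdf_mono ereal_minus_mono) auto
    then show "- C (ext_cdf (cdf P) (a - ereal z)) v \<le> - C (ext_cdf (cdf P) (a - ereal z')) v"
      using P.ext_cdf_in[of "a - ereal z"] P.ext_cdf_in[of "a - ereal z'"]
        copula2_mono[OF assms(3) _ _ _ assms(4)] by simp
  qed
  then have "(\<lambda>z. - C (ext_cdf (cdf P) (a - ereal z)) v) \<in> borel_measurable borel"
    by (rule borel_measurable_mono)
  then have "(\<lambda>z. C (ext_cdf (cdf P) (a - ereal z)) v) \<in> borel_measurable borel"
    by simp
  moreover have "\<bar>C (ext_cdf (cdf P) (a - ereal z)) v\<bar> \<le> 1" for z
    using copula2_in[OF assms(3) P.ext_cdf_in[of "a - ereal z"] assms(4)] by simp
  ultimately show ?thesis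
    by (intro N.integrable_const_bound[of _ 1]) (auto cong: measurable_cong_sets)
qed

lemma copula2_mixture:
  assumes "real_distribution N" "real_distribution P" "real_distribution R"
    and cop: "copula2 C" and cont: "continuous_on UNIV (cdf R)"
    and conv: "\<And>x. cdf R x = (\<integral>z. cdf P (x - z) \<partial>N)"
  shows "copula2 (\<lambda>u v. \<integral>z. C (ext_cdf (cdf P) (cdf_inv (cdf R) u - ereal z)) v \<partial>N)"
proof -
  interpret N: real_distribution N by fact
  interpret P: real_distribution P by fact
  interpret R: real_distribution R by fact
  define E where "E u z = ext_cdf (cdf P) (cdf_inv (cdf R) u - ereal z)" for u z
  have E: "E u z \<in> {0..1}" for u z by (simp add: E_def P.ext_cdf_in del: atLeastAtMost_iff)
  have E0: "E 0 z = 0" for z by (simp add: E_def cdf_inv_def ext_cdf_def)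
  have int: "integrable N (\<lambda>z. C (E u z) v)" if "v \<in> {0..1}" for u v
    unfolding E_def using assms that by (intro integrable_copula2_ext_cdf)
  have C1: "C (E u z) 1 = E u z" for u z by (rule copula2_margins(4)[OF cop E])
  have intE: "integrable N (E u)" for u using int[of 1 u] by (simp add: C1)
  \<comment> \<open>If the inverse is a real \<open>r\<close>, the mean is
    \<open>cdf R r = u\<close> by \<open>conv\<close>; if it is infinite, \<open>E u\<close> is
    constantly 0 or 1.\<close>
  have Eu: "(\<integral>z. E u z \<partial>N) = u" if "0 \<le> u" "u \<le> 1" for u
    by (rule R.cdf_inv_cases[OF cont that])
       (auto simp: E_def ext_cdf_def conv[symmetric] N.prob_space[simplified])
  have Emono: "E u z \<le> E w z" if "0 \<le> u" "u \<le> w" "w \<le> 1" for u w z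
    unfolding E_def using R.cdf_inv_mono[OF cont that] by (intro P.ext_cdf_mono ereal_minus_mono) auto
  show ?thesis
    unfolding copula2_def E_def[symmetric]
  proof (intro conjI ballI allI impI)
    fix u v :: real assume uv: "u \<in> {0..1}" "v \<in> {0..1}"
    have "0 \<le> C (E u z) v" "C (E u z) v \<le> 1" for z
      using copula2_in[OF cop E uv(2), of u z] by auto
    then show "(\<integral>z. C (E u z) v \<partial>N) \<in> {0..1}"
      using int[of v u] uv by (auto intro!: integral_nonneg_AE N.integral_le_const)
  next
    fix v :: real assume v: "v \<in> {0..1}"
    show "(\<integral>z. C (E 0 z) v \<partial>N) = 0" by (simp add: E0 copula2_margins(1)[OF cop v])
    have "C (E v z) 0 = 0" for z by (rule copula2_margins(2)[OF cop E])
    then show "(\<integral>z. C (E v z) 0 \<partial>N) = 0" by simp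
    show "(\<integral>z. C (E v z) 1 \<partial>N) = v" using v by (simp add: C1 Eu)
    \<comment> \<open>\<open>E 1 z\<close> may differ from 1 on a null set, when 1 is attained by
      \<open>cdf R\<close>. The integral is therefore squeezed between \<open>v\<close> and the mean
      of \<open>E 1 z + v - 1\<close>, which is again \<open>v\<close>.\<close>
    show "(\<integral>z. C (E 1 z) v \<partial>N) = v"
    proof (rule antisym)
      show "(\<integral>z. C (E 1 z) v \<partial>N) \<le> v"
        using copula2_le[OF cop E v] int v by (intro N.integral_le_const) auto
      have "v = (\<integral>z. E 1 z + (v - 1) \<partial>N)"
        using intE by (simp add: Eu N.prob_space[simplified])
      also have "\<dots> \<le> (\<integral>z. C (E 1 z) v \<partial>N)"
        using copula2_ge[OF cop E v] int[OF v] intE by (intro integral_mono) (auto simp: algebra_simps)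
      finally show "v \<le> (\<integral>z. C (E 1 z) v \<partial>N)" .
    qed
  next
    fix x1 x2 y1 y2 :: real
    assume h: "0 \<le> x1 \<and> x1 \<le> x2 \<and> x2 \<le> 1 \<and> 0 \<le> y1 \<and> y1 \<le> y2 \<and> y2 \<le> 1"
    then have y: "y1 \<in> {0..1}" "y2 \<in> {0..1}" by auto
    have "0 \<le> C (E x1 z) y1 + C (E x2 z) y2 - C (E x1 z) y2 - C (E x2 z) y1" for z
      using E[of x1 z] E[of x2 z] Emono[of x1 x2 z] h by (intro copula2_rect[OF cop]) auto
    then have "0 \<le> (\<integral>z. C (E x1 z) y1 + C (E x2 z) y2 - C (E x1 z) y2 - C (E x2 z) y1 \<partial>N)"
      by (intro integral_nonneg_AE) simp
    then show "0 \<le> (\<integral>z. C (E x1 z) y1 \<partial>N) + (\<integral>z. C (E x2 z) y2 \<partial>N)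
        - (\<integral>z. C (E x1 z) y2 \<partial>N) - (\<integral>z. C (E x2 z) y1 \<partial>N)"
      using int y by simp
  qed
qed

text \<open>Continuity makes both distribution functions attain every value in the open unit interval,
  and a copula is determined by its margins on the boundary of the unit square.\<close>

lemma has_copula_unique:
  fixes V W :: "'a \<Rightarrow> real"
  assumes "prob_space M" and [measurable]: "V \<in> borel_measurable M" "W \<in> borel_measurable M"
    and cont: "continuous_on UNIV (cdf (distr M borel V))" "continuous_on UNIV (cdf (distr M borel W))"
    and cop: "has_copula M V W C" "has_copula M V W D"
    and uv: "u \<in> {0..1}" "v \<in> {0..1}"
  shows "C u v = D u v"
proof -
  interpret prob_space M by fact
  interpret V: real_distribution "distr M borel V" by simp
  interpret W: real_distribution "distr M borel W" by simp
  consider "u \<in> {0,1} \<or> v \<in> {0,1}" | "0 < u" "u < 1" "0 < v" "v < 1"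
    using uv by fastforce
  then show ?thesis
  proof cases
    case 1
    then show ?thesis
      using cop copula2_margins[of C] copula2_margins[of D] uv unfolding has_copula_def by auto
  next
    case 2
    obtain x where "cdf (distr M borel V) x = u" by (rule V.cdf_onto[OF cont(1) 2(1,2)])
    moreover obtain y where "cdf (distr M borel W) y = v" by (rule W.cdf_onto[OF cont(2) 2(3,4)])
    ultimately show ?thesis using cop unfolding has_copula_def by metis
  qed
qed

section \<open>The copula of the sum as an integral over the law of \<open>Z\<close>\<close>

lemma (in prob_space) cdf_distr_eq_prob:
  assumes "V \<in> borel_measurable M"
  shows "cdf (distr M borel V) x = prob {\<omega> \<in> space M. V \<omega> \<le> x}"
  using assms by (auto simp: cdf_def measure_distr intro!: arg_cong[where f=prob])

text \<open>The two events differ only where \<open>r < V \<le> x\<close>, which has probability 0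
  by \<open>eq\<close>.\<close>

lemma (in prob_space) joint_cdf_cong_cdf:
  assumes [measurable]: "V \<in> borel_measurable M" "W \<in> borel_measurable M"
    and eq: "cdf (distr M borel V) r = cdf (distr M borel V) x" and "r \<le> x"
  shows "joint_cdf M V W r y = joint_cdf M V W x y"
proof (rule antisym)
  show "joint_cdf M V W r y \<le> joint_cdf M V W x y"
    using \<open>r \<le> x\<close> unfolding joint_cdf_def by (intro finite_measure_mono) auto
  have "joint_cdf M V W x y \<le> prob ({\<omega> \<in> space M. V \<omega> \<le> r \<and> W \<omega> \<le> y}
      \<union> ({\<omega> \<in> space M. V \<omega> \<le> x} - {\<omega> \<in> space M. V \<omega> \<le> r}))"
    unfolding joint_cdf_def by (intro finite_measure_mono) auto
  also have "\<dots> \<le> joint_cdf M V W r y + prob ({\<omega> \<in> space M. V \<omega> \<le> x} - {\<omega> \<in> space M. V \<omega> \<le> r})"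
    unfolding joint_cdf_def by (intro measure_Un_le) auto
  also have "prob ({\<omega> \<in> space M. V \<omega> \<le> x} - {\<omega> \<in> space M. V \<omega> \<le> r}) = 0"
    using eq \<open>r \<le> x\<close> by (subst finite_measure_Diff) (auto simp: cdf_distr_eq_prob)
  finally show "joint_cdf M V W x y \<le> joint_cdf M V W r y" by simp
qed

text \<open>At a positive value of the distribution function of the sum, the inverse returns a real
  \<open>r\<close> to the left of \<open>x\<close> on the same level. There the integrand is the
  joint distribution function of \<open>(X, Y)\<close> shifted by \<open>z\<close>, and
  \<open>r\<close> may be exchanged for \<open>x\<close>.\<close>

lemma (in prob_space) has_copula_add:
  fixes X Y Z :: "'a \<Rightarrow> real"
  assumes [measurable]: "X \<in> borel_measurable M" "Y \<in> borel_measurable M"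
    and ind: "indep_rv M borel Z (borel \<Otimes>\<^sub>M borel) (\<lambda>\<omega>. (X \<omega>, Y \<omega>))"
    and cont: "continuous_on UNIV (cdf (distr M borel Z))"
    and cop: "has_copula M X Y C"
    and conv: "\<And>x. cdf (distr M borel (\<lambda>\<omega>. X \<omega> + Z \<omega>)) x
      = (\<integral>z. cdf (distr M borel X) (x - z) \<partial>distr M borel Z)"
  shows "has_copula M (\<lambda>\<omega>. X \<omega> + Z \<omega>) Y (\<lambda>u v. \<integral>z. C (ext_cdf (cdf (distr M borel X))
    (cdf_inv (cdf (distr M borel (\<lambda>\<omega>. X \<omega> + Z \<omega>))) u - ereal z)) v \<partial>distr M borel Z)"
    (is "has_copula M ?S Y ?K")
proof -
  have [measurable]: "Z \<in> borel_measurable M" using ind by (simp add: indep_rv_def)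
  let ?F = "cdf (distr M borel ?S)" and ?G = "cdf (distr M borel Y)"
  interpret S: real_distribution "distr M borel ?S" by simp
  interpret Y: real_distribution "distr M borel Y" by simp
  have contS: "continuous_on UNIV ?F"
    by (rule continuous_cdf_add[OF _ _ ind cont]) auto
  have "copula2 ?K"
    using cop contS by (intro copula2_mixture conv) (auto simp: has_copula_def)
  have "?K (?F x) (?G y) = joint_cdf M ?S Y x y" for x y
  proof (cases "?F x = 0")
    \<comment> \<open>Here the inverse is \<open>-\<infinity>\<close> by convention and gives no
      point \<open>r\<close>; both sides vanish instead.\<close>
    case True
    have "joint_cdf M ?S Y x y \<le> ?F x"
      unfolding joint_cdf_def cdf_distr_eq_prob[of ?S, simplified] by (intro finite_measure_mono) auto
    then have "joint_cdf M ?S Y x y = 0"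
      using True by (simp add: joint_cdf_def antisym)
    moreover have "?G y \<in> {0..1}" by (simp add: Y.cdf_nonneg Y.cdf_bounded_prob)
    then have "?K 0 (?G y) = 0" by (rule copula2_margins(1)[OF \<open>copula2 ?K\<close>])
    ultimately show ?thesis unfolding True by simp
  next
    case False
    then have "0 < ?F x" using S.cdf_nonneg[of x] by simp
    then obtain r where r: "r \<le> x" "cdf_inv ?F (?F x) = ereal r" "?F r = ?F x"
      by (rule S.cdf_inv_attained[OF contS]) simp
    have "?K (?F x) (?G y) = (\<integral>z. C (cdf (distr M borel X) (r - z)) (?G y) \<partial>distr M borel Z)"
      by (simp add: r(2) ext_cdf_def)
    also have "\<dots> = (\<integral>z. joint_cdf M X Y (r - z) y \<partial>distr M borel Z)"
      using cop by (simp add: has_copula_def)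
    also have "\<dots> = joint_cdf M ?S Y r y"
      by (rule joint_cdf_add[symmetric, OF _ _ ind]) auto
    also have "\<dots> = joint_cdf M ?S Y x y"
      using r by (intro joint_cdf_cong_cdf) auto
    finally show ?thesis .
  qed
  with \<open>copula2 ?K\<close> show ?thesis by (simp add: has_copula_def)
qed

section \<open>From the law of \<open>Z\<close> to the formula for \<open>C5\<close>\<close>

theorem proposition1p2p3:
  fixes M :: "'a measure"
    and X Y Z :: "'a \<Rightarrow> real"
    and C C5 H :: "real \<Rightarrow> real \<Rightarrow> real"
    and F1 F2 F3 F4 f3 :: "real \<Rightarrow> real"
  assumes "prob_space M"
    and "X \<in> borel_measurable M" and "Y \<in> borel_measurable M" and "Z \<in> borel_measurable M"
    and "H = joint_cdf M X Y"
    and "has_copula M X Y C"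
    and "F1 = cdf (distr M borel X)"
    and "F2 = cdf (distr M borel Y)"
    and "F3 = cdf (distr M borel Z)"
    and "\<And>t. 0 \<le> f3 t"
    and "distributed M lborel Z (\<lambda>t. ennreal (f3 t))"
    and "indep_rv M borel Z (borel \<Otimes>\<^sub>M borel) (\<lambda>\<omega>. (X \<omega>, Y \<omega>))"
    and F4: "F4 = (\<lambda>x. LBINT t. F1 (x - t) * f3 t)"
    and C5: "C5 = (\<lambda>u v. LBINT t:{0..1}. C (ext_cdf F1 (cdf_inv F4 u - cdf_inv F3 t)) v)"
  shows "(\<forall>x. integrable lborel (\<lambda>t. F1 (x - t) * f3 t))
    \<and> cdf (distr M borel (\<lambda>\<omega>. X \<omega> + Z \<omega>)) = F4
    \<and> (\<forall>u\<in>{0..1}. \<forall>v\<in>{0..1}.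
         set_integrable lborel {0..1} (\<lambda>t. C (ext_cdf F1 (cdf_inv F4 u - cdf_inv F3 t)) v))
    \<and> has_copula M (\<lambda>\<omega>. X \<omega> + Z \<omega>) Y C5
    \<and> (continuous_on UNIV F2 \<longrightarrow>
         (\<forall>C'. has_copula M (\<lambda>\<omega>. X \<omega> + Z \<omega>) Y C' \<longrightarrow>
            (\<forall>u\<in>{0..1}. \<forall>v\<in>{0..1}. C' u v = C5 u v)))"
proof -
  interpret prob_space M by fact
  note [measurable] = \<open>X \<in> borel_measurable M\<close> \<open>Y \<in> borel_measurable M\<close> \<open>Z \<in> borel_measurable M\<close>
  note cop = \<open>has_copula M X Y C\<close>
    and ind = \<open>indep_rv M borel Z (borel \<Otimes>\<^sub>M borel) (\<lambda>\<omega>. (X \<omega>, Y \<omega>))\<close>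
    and dens = \<open>distributed M lborel Z (\<lambda>t. ennreal (f3 t))\<close>
    and f3 = \<open>\<And>t. 0 \<le> f3 t\<close>
    and F = \<open>F1 = cdf (distr M borel X)\<close> \<open>F2 = cdf (distr M borel Y)\<close> \<open>F3 = cdf (distr M borel Z)\<close>
  let ?N = "distr M borel Z" and ?S = "\<lambda>\<omega>. X \<omega> + Z \<omega>"
  interpret N: real_distribution ?N by simp
  interpret P: real_distribution "distr M borel X" by simp
  have f3m: "f3 \<in> borel_measurable lborel"
    by (rule distributed_real_measurable[OF f3 dens])
  have N: "?N = density lborel f3"
    using distributed_distr_eq_density[OF dens] by (simp cong: distr_cong)
  \<comment> \<open>A law with a density has no atoms, which makes \<open>F3\<close>
    continuous.\<close>
  have "emeasure ?N {x} = 0" for x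
    unfolding N using f3m by (subst emeasure_density) (auto intro!: nn_integral_null_set)
  then have contF3: "continuous_on UNIV (cdf ?N)"
    by (simp add: continuous_on_eq_continuous_at N.isCont_cdf measure_def)

  \<comment> \<open>Facts about \<open>X\<close> alone are those about the pair \<open>(X, 0)\<close>.\<close>
  have indX: "indep_rv M borel Z (borel \<Otimes>\<^sub>M borel) (\<lambda>\<omega>. (X \<omega>, 0::real))"
    using indep_rv_compose[OF ind, of "\<lambda>p. (fst p, 0)" "borel \<Otimes>\<^sub>M borel"] by simp
  have jX: "joint_cdf M V (\<lambda>\<omega>. 0) x 0 = cdf (distr M borel V) x"
    if "V \<in> borel_measurable M" for V x
    by (simp add: joint_cdf_def cdf_distr_eq_prob that)
  have int: "integrable ?N (\<lambda>t. F1 (x - t))" for x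
    using integrable_joint_cdf_shift[OF _ _ indX, of x 0] by (simp add: jX F)
  have conv: "cdf (distr M borel ?S) x = (\<integral>z. F1 (x - z) \<partial>?N)" for x
    using joint_cdf_add[OF _ _ indX, of x 0] by (simp add: jX F)
  have F1m: "(\<lambda>t. F1 (x - t)) \<in> borel_measurable lborel" for x
    using int[of x] by (auto cong: measurable_cong_sets)
  have F4_int: "integrable lborel (\<lambda>t. F1 (x - t) * f3 t)" for x
    using int[of x] f3 f3m F1m[of x] unfolding N
    by (subst (asm) integrable_real_density) (auto simp: mult.commute)
  have "cdf (distr M borel ?S) x = F4 x" for x
    unfolding conv F4 N using f3 f3m F1m[of x] by (subst integral_real_density) (auto simp: mult.commute)
  then have F4_cdf: "cdf (distr M borel ?S) = F4" by blast
  have intC: "integrable ?N (\<lambda>z. C (ext_cdf F1 (a - ereal z)) v)" if "v \<in> {0..1}" for a v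
    using cop that unfolding F by (intro integrable_copula2_ext_cdf) (auto simp: has_copula_def)
  \<comment> \<open>The quantile transformation is applied to
    \<open>g w = C (ext_cdf F1 (cdf_inv F4 u - w)) v\<close> with \<open>w\<close> in
    \<open>ereal\<close>.\<close>
  have C5_int: "set_integrable lborel {0..1} (\<lambda>t. C (ext_cdf F1 (cdf_inv F4 u - cdf_inv F3 t)) v)"
    if "v \<in> {0..1}" for u v
    unfolding F(3) by (rule N.set_integrable_cdf_inv[OF contF3 intC[OF that]])
  have C5_eq: "C5 u v = (\<integral>z. C (ext_cdf F1 (cdf_inv F4 u - ereal z)) v \<partial>?N)" if "v \<in> {0..1}" for u v
    unfolding C5 F(3) by (rule N.integral_cdf_inv[OF contF3 intC[OF that]])
  have contF4: "continuous_on UNIV (cdf (distr M borel ?S))"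
    by (rule continuous_cdf_add[OF _ _ ind contF3]) auto
  have "has_copula M ?S Y (\<lambda>u v. \<integral>z. C (ext_cdf F1 (cdf_inv F4 u - ereal z)) v \<partial>?N)"
    unfolding F4_cdf[symmetric] F(1)
    by (rule has_copula_add[OF _ _ ind contF3 cop]) (auto simp: conv F)
  \<comment> \<open>This allows \<open>C5_eq\<close> to be used at the values of
    \<open>F2\<close>.\<close>
  moreover have "cdf (distr M borel Y) y \<in> {0..1}" for y
    using real_distribution.cdf_bounded_prob[of "distr M borel Y" y]
    by (simp add: cdf_def)
  ultimately have C5_cop: "has_copula M ?S Y C5"
    using copula2_cong[OF _ C5_eq] unfolding has_copula_def by (simp add: C5_eq)
  \<comment> \<open>Both margins are continuous: the first because \<open>Z\<close> has a density,
    the second by assumption.\<close>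
  moreover have "C' u v = C5 u v" if "continuous_on UNIV F2" "has_copula M ?S Y C'"
    "u \<in> {0..1}" "v \<in> {0..1}" for C' u v
    using that contF4 C5_cop \<open>prob_space M\<close> unfolding F(2)
    by (intro has_copula_unique[of M ?S Y C' C5]) auto
  ultimately show ?thesis
    using F4_int F4_cdf C5_int by auto
qed

end
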